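(* Let $N\ge2$ and $\gamma\in(\frac1{N+1},\frac1N]$, and let $\epsilon,\delta>0$ satisfy $\epsilon>(N-1)\delta$. For $k\in\{0,N-1\}$ let $f_{e_k}\in C^{N-1}_b(\mathbb R;\mathbb R)$ be such that $f_{e_k}^{(k)}(0)=1$ and $f_{e_k}^{(j)}(0)=0$ for all $j\in\{0,\dots,N-1\}\setminus\{k\}$. Define, for $x=(x_1,x_2)$ with $x_1>0$, $$\phi(x)=\big(x_1^{\frac1N+\epsilon}f_{e_{N-1}}(x_2),\ x_1^{\frac1N-\delta}f_{e_0}(x_2)\big)^T\in\mathbb R^2 .$$ Let $\mathbf X$ be the branched rough path over $\mathbb R$ (i.e. $d=1$) given by $\mathbf X_t=\mathbf 1+t\,[\bullet^{N-1}]$, where $\bullet$ is the one-vertex tree; that is, $\langle\mathbf X_t,\mathbf 1\rangle=1$, $\langle\mathbf X_t,[\bullet^{N-1}]\rangle=t$, and $\langle\mathbf X_t,h\rangle=0$ for all other forests $h$ with $1\le|h|\le N$. Then the branched rough differential equation $$\mathrm d\mathbf Y_t=\phi(\mathbf Y_t)\,\mathrm d\mathbf X_t,\qquad Y_0=(1,0)^T,$$ explodes in finite time.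
   Context: Trees and forests ($d=1$, so labels are omitted). $\mathcal T$ is the set of finite (non-planar) rooted trees, together with the empty tree $\mathbf 1$; $\mathcal F$ is the set of forests, i.e. finite commutative products (repetitions allowed) of nonempty trees, the empty product being $\mathbf 1$. $|f|$ is the number of vertices and $\#f$ the number of trees counted with multiplicity; $\mathcal F_n=\{f\in\mathcal F:|f|\le n\}$. $[f]$ is the tree obtained by joining the roots of all trees in $f$ to a new root; $[\bullet^{N-1}]$ is thus a root with $N-1$ leaves attached. Hopf algebra. $\mathcal H$ is the real vector space with basis $\mathcal F$ and the product of forests. The coproduct $\Delta$ is the algebra morphism with $\Delta\mathbf 1=\mathbf 1\otimes\mathbf 1$ and $\Delta[f]=[f]\otimes\mathbf 1+(\mathrm{id}\otimes[\cdot])\Delta f$. For linear functionals $x,y$ on $\mathcal H$, $\langle x\star y,h\rangle=\langle x\otimes y,\Delta h\rangle$. $G_N$ is the group (under $\star$) of characters of $\mathcal H$, modulo identification of characters agreeing on $\mathcal F_N$. A $\gamma$-Hölder branched rough path on $[0,T]$ is a map $\mathbf X:[0,T]\to G_N$ such that, with $\mathbf X_{st}:=\mathbf X_s^{-1}\star\mathbf X_t$, $\sup_{s<t}|\langle\mathbf X_{st},f\rangle|/|t-s|^{\gamma|f|}<\infty$ for all $f\in\mathcal F_N$. The $\mathbf X$ of the claim is such a path on every $[0,T]$. Controlled rough path. On an interval $J\subseteq[0,\infty)$, an $\mathbb R^m$-valued $\mathbf X$-controlled rough path is a family $(\partial^f_XY)_{f\in\mathcal F_{N-1}}$ of paths $J\to\mathbb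 R^m$, $Y_t:=\partial^{\mathbf 1}_XY_t$, such that $R^{\mathbf Y,f}_{st}:=\partial^f_XY_t-\sum_{g\in\mathcal F_{N-1}}\langle\mathbf X_{st}\otimes f,\Delta g\rangle\partial^g_XY_s$ satisfies $\sup|R^{\mathbf Y,f}_{st}|/|t-s|^{(N-|f|)\gamma}<\infty$ over $s<t$ in each compact subinterval of $J$, for each $f\in\mathcal F_{N-1}$. For $f\in\mathcal F_{N-1}$, $\partial^f_X\phi(\mathbf Y)=\sum_{\tau_1\cdots\tau_{\#f}=f}\frac1{(\#f)!}D^{\#f}\phi(Y)[\partial_X^{\tau_1}Y,\dots,\partial_X^{\tau_{\#f}}Y]$ (sum over ordered tuples of nonempty trees with product $f$). The rough integral is $\int_s^t\phi(\mathbf Y_r)\,\mathrm d\mathbf X_r=\lim_{|\mathcal P|\to0}\sum_{(u,v)\in\mathcal P}\sum_{f\in\mathcal F_{N-1}}\partial^f_X\phi(\mathbf Y_u)\langle\mathbf X_{uv},[f]\rangle$. Solution. $\mathbf Y$ is a solution on $J\ni0$ if $Y_t=Y_0+\int_0^t\phi(\mathbf Y_s)\,\mathrm d\mathbf X_s$ for $t\in J$, $\partial^{[f]}_XY=\partial^f_X\phi(\mathbf Y)$ for all $f\in\mathcal F_{N-2}$, and $\partial^f_XY=0$ for $f\in\mathcal F_{N-1}$ with $\#f\ge2$. The equation explodes in finite time if there are $\xi\in(0,\infty)$ and a solution on $[0,\xi)$ from the given initial condition with $\|Y_t\|\to\infty$ as $t\uparrow\xi$. $C^n_b$ denotes functions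 with bounded continuous derivatives up to order $n$. *)

theory Defs
  imports
    "HOL-Analysis.Analysis"
    "HOL-Algebra.Group"
    "HOL-Combinatorics.Multiset_Permutations"
    "HOL-Library.Poly_Mapping"
begin

section \<open>Rooted trees and forests\<close>

text \<open>
  Nonempty, non-planar, unlabelled finite rooted trees; \<open>Node f\<close> is \<open>[f]\<close>. A forest is a
  multiset of nonempty trees, the product of forests is \<open>+\<close>, and \<open>{#}\<close> is the empty forest,
  which is also the empty tree. The number of trees \<open>#f\<close> is \<open>size f\<close>.
\<close>

datatype rtree = Node "rtree multiset"

type_synonym forest = "rtree multiset"

primrec tree_vertices :: "rtree \<Rightarrow> nat" where
  "tree_vertices (Node f) = Suc (\<Sum>\<^sub># (image_mset tree_vertices f))"

definition vertices :: "forest \<Rightarrow> nat" where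
  "vertices f = \<Sum>\<^sub># (image_mset tree_vertices f)"

definition forests_upto :: "nat \<Rightarrow> forest set" where
  "forests_upto n = {f. vertices f \<le> n}"

definition graft :: "forest \<Rightarrow> forest" where
  "graft f = {#Node f#}"

definition bullet :: rtree where
  "bullet = Node {#}"

text \<open>The tree \<open>[\<bullet>\<^sup>n]\<close>, regarded as a forest.\<close>

definition corolla :: "nat \<Rightarrow> forest" where
  "corolla n = graft (replicate_mset n bullet)"

lemma finite_forests_upto: "finite (forests_upto n)"
proof (induction n)
  case 0
  have "f = {#}" if "vertices f = 0" for f
  proof (cases f)
    case (add t h)
    with that show ?thesis by (cases t) (simp add: vertices_def)
  qed simp
  then have "forests_upto 0 \<subseteq> {{#}}"
    by (auto simp: forests_upto_def)
  then show ?case by (rule finite_subset) simp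
next
  case (Suc n)
  have "forests_upto (Suc n)
      \<subseteq> insert {#} ((\<lambda>(g, h). add_mset (Node g) h) ` (forests_upto n \<times> forests_upto n))"
  proof
    fix f assume f: "f \<in> forests_upto (Suc n)"
    show "f \<in> insert {#} ((\<lambda>(g, h). add_mset (Node g) h) ` (forests_upto n \<times> forests_upto n))"
    proof (cases f)
      case (add t h)
      obtain g where t: "t = Node g" by (cases t)
      have "(g, h) \<in> forests_upto n \<times> forests_upto n"
        using f add t by (auto simp: forests_upto_def vertices_def)
      then show ?thesis using add t by auto
    qed simp
  qed
  then show ?case
    by (rule finite_subset) (use Suc.IH in auto)
qed


section \<open>The Hopf algebra and the groups \<open>G\<^sub>N\<close>\<close>

text \<open>
  The algebra with basis the forests is \<open>forest \<Rightarrow>\<^sub>0 real\<close>, whose multiplication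
  extends the product of forests bilinearly; in the same way \<open>(forest \<times> forest) \<Rightarrow>\<^sub>0 real\<close>
  is its tensor square. Linear maps out of the algebra are given by their values on forests.
\<close>

definition graft_right ::
  "((forest \<times> forest) \<Rightarrow>\<^sub>0 real) \<Rightarrow> ((forest \<times> forest) \<Rightarrow>\<^sub>0 real)" where
  "graft_right p =
     (\<Sum>(g, h) \<in> Poly_Mapping.keys p.
        Poly_Mapping.single (g, graft h) (Poly_Mapping.lookup p (g, h)))"

primrec tree_coproduct :: "rtree \<Rightarrow> ((forest \<times> forest) \<Rightarrow>\<^sub>0 real)" where
  "tree_coproduct (Node f) =
     Poly_Mapping.single (graft f, {#}) 1
     + graft_right (\<Prod>\<^sub># (image_mset tree_coproduct f))"

definition coproduct :: "forest \<Rightarrow> ((forest \<times> forest) \<Rightarrow>\<^sub>0 real)" where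
  "coproduct f = \<Prod>\<^sub># (image_mset tree_coproduct f)"

lemma coproduct_empty: "coproduct {#} = Poly_Mapping.single ({#}, {#}) 1"
  by (simp add: coproduct_def flip: single_one) (simp add: zero_prod_def)

lemma coproduct_plus: "coproduct (f + g) = coproduct f * coproduct g"
  by (simp add: coproduct_def)

lemma coproduct_graft:
  "coproduct (graft f) = Poly_Mapping.single (graft f, {#}) 1 + graft_right (coproduct f)"
  by (simp add: coproduct_def graft_def)

type_synonym functional = "forest \<Rightarrow> real"

definition tensor_pairing ::
  "functional \<Rightarrow> functional \<Rightarrow> ((forest \<times> forest) \<Rightarrow>\<^sub>0 real) \<Rightarrow> real" where
  "tensor_pairing x y p =
     (\<Sum>(g, h) \<in> Poly_Mapping.keys p. Poly_Mapping.lookup p (g, h) * (x g * y h))"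

definition star :: "functional \<Rightarrow> functional \<Rightarrow> functional" where
  "star x y f = tensor_pairing x y (coproduct f)"

text \<open>The functional dual to the basis element \<open>f\<close>.\<close>

definition dual_forest :: "forest \<Rightarrow> functional" where
  "dual_forest f = (\<lambda>h. if h = f then 1 else 0)"

definition is_character :: "functional \<Rightarrow> bool" where
  "is_character x \<longleftrightarrow> x {#} = 1 \<and> (\<forall>f g. x (f + g) = x f * x g)"

definition agree_upto :: "nat \<Rightarrow> (functional \<times> functional) set" where
  "agree_upto N =
     {(x, y). is_character x \<and> is_character y \<and> (\<forall>f \<in> forests_upto N. x f = y f)}"

text \<open>The counit \<open>dual_forest {#}\<close> represents the neutral element of \<open>G\<^sub>N\<close>.\<close>

definition G :: "nat \<Rightarrow> functional set monoid" where
  "G N = \<lparr>carrier = {x. is_character x} // agree_upto N,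
          mult = (\<lambda>A B. \<Union>x\<in>A. \<Union>y\<in>B. agree_upto N `` {star x y}),
          one = agree_upto N `` {dual_forest {#}}\<rparr>"

text \<open>
  \<open>\<langle>A, f\<rangle>\<close> for \<open>A\<close> in \<open>G\<^sub>N\<close> and a forest \<open>f\<close> with at most \<open>N\<close> vertices: the common value at \<open>f\<close>
  of all representatives of \<open>A\<close>.
\<close>

definition pairing :: "functional set \<Rightarrow> forest \<Rightarrow> real" where
  "pairing A f = the_elem ((\<lambda>x. x f) ` A)"

lemma pairing_class:
  assumes "is_character x" "f \<in> forests_upto N"
  shows "pairing (agree_upto N `` {x}) f = x f"
proof -
  have "(\<lambda>y. y f) ` (agree_upto N `` {x}) = {x f}"
    using assms by (auto simp: agree_upto_def image_iff)
  then show ?thesis by (simp add: pairing_def)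
qed

lemma character_prod_mset: "is_character (\<lambda>f. \<Prod>\<^sub># (image_mset a f))"
  by (simp add: is_character_def)

lemma vertices_add: "vertices (add_mset t h) = tree_vertices t + vertices h"
  by (simp add: vertices_def)

lemma vertices_corolla: "vertices (corolla n) = Suc n"
  by (induction n) (simp_all add: vertices_def corolla_def graft_def bullet_def)

text \<open>The element \<open>1 + t [\<bullet>\<^sup>N\<^sup>-\<^sup>1]\<close> of \<open>G\<^sub>N\<close> exists.\<close>

lemma exists_corolla_element:
  fixes t :: real
  assumes "N \<ge> 2"
  shows "\<exists>A \<in> carrier (G N). pairing A {#} = 1 \<and> pairing A (corolla (N - 1)) = t \<and>
    (\<forall>h \<in> forests_upto N. h \<noteq> {#} \<and> h \<noteq> corolla (N - 1) \<longrightarrow> pairing A h = 0)"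
proof -
  define T where "T = Node (replicate_mset (N - 1) bullet)"
  define x where "x = (\<lambda>f. \<Prod>\<^sub># (image_mset (\<lambda>\<tau>. if \<tau> = T then t else (0::real)) f))"
  have c: "is_character x" unfolding x_def by (rule character_prod_mset)
  have T: "corolla (N - 1) = {#T#}" by (simp add: T_def corolla_def graft_def)
  have vT: "tree_vertices T = N" using vertices_corolla[of "N - 1"] assms
    unfolding T by (simp add: vertices_def)
  have z: "x h = 0" if h: "vertices h \<le> N" "h \<noteq> {#}" "h \<noteq> {#T#}" for h
  proof (cases "\<exists>\<tau> \<in># h. \<tau> \<noteq> T")
    case True then show ?thesis by (auto simp: x_def prod_mset_zero_iff)
  next
    case False
    obtain u k where h2: "h = add_mset u k" using h(2) by (cases h) auto
    then have u: "u = T" and k: "k \<noteq> {#}" using False h(3) by auto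
    obtain u' k' where k2: "k = add_mset u' k'" using k by (cases k) auto
    then have "u' = T" using h2 False by auto
    then have "vertices h \<ge> 2 * N" using h2 k2 u vT by (simp add: vertices_add)
    then show ?thesis using h(1) assms by simp
  qed
  show ?thesis
  proof (rule bexI[of _ "agree_upto N `` {x}"])
    show "agree_upto N `` {x} \<in> carrier (G N)" using c by (auto simp: G_def quotient_def)
    have "{#} \<in> forests_upto N" "{#T#} \<in> forests_upto N"
      using vT by (simp_all add: forests_upto_def vertices_def)
    moreover have "x {#} = 1" "x {#T#} = t" by (simp_all add: x_def)
    ultimately show "pairing (agree_upto N `` {x}) {#} = 1 \<and>
        pairing (agree_upto N `` {x}) (corolla (N - 1)) = t \<and>
        (\<forall>h \<in> forests_upto N. h \<noteq> {#} \<and> h \<noteq> corolla (N - 1) \<longrightarrow>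
           pairing (agree_upto N `` {x}) h = 0)"
      unfolding T using z pairing_class[OF c] by (auto simp: forests_upto_def)
  qed
qed

definition increment :: "nat \<Rightarrow> (real \<Rightarrow> functional set) \<Rightarrow> real \<Rightarrow> real \<Rightarrow> functional set" where
  "increment N X s t = inv\<^bsub>G N\<^esub> (X s) \<otimes>\<^bsub>G N\<^esub> X t"


section \<open>Branched rough paths, controlled rough paths and rough integrals\<close>

definition branched_rough_path ::
  "nat \<Rightarrow> real \<Rightarrow> real \<Rightarrow> (real \<Rightarrow> functional set) \<Rightarrow> bool" where
  "branched_rough_path N \<gamma> T X \<longleftrightarrow>
     (\<forall>t \<in> {0..T}. X t \<in> carrier (G N)) \<and>
     (\<forall>f \<in> forests_upto N. \<exists>C. \<forall>s t. 0 \<le> s \<and> s < t \<and> t \<le> T \<longrightarrow>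
        \<bar>pairing (increment N X s t) f\<bar> / \<bar>t - s\<bar> powr (\<gamma> * real (vertices f)) \<le> C)"

text \<open>In the following, \<open>Y f t\<close> is the value at time \<open>t\<close> of the path \<open>\<partial>\<^sup>f Y\<close>; in particular
  \<open>Y {#}\<close> is the underlying path.\<close>

definition remainder ::
  "nat \<Rightarrow> (real \<Rightarrow> functional set) \<Rightarrow> (forest \<Rightarrow> real \<Rightarrow> 'a::euclidean_space)
    \<Rightarrow> forest \<Rightarrow> real \<Rightarrow> real \<Rightarrow> 'a" where
  "remainder N X Y f s t =
     Y f t - (\<Sum>g \<in> forests_upto (N - 1).
       tensor_pairing (pairing (increment N X s t)) (dual_forest f) (coproduct g) *\<^sub>R Y g s)"

definition controlled_rough_path ::
  "nat \<Rightarrow> real \<Rightarrow> (real \<Rightarrow> functional set) \<Rightarrow> real set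
    \<Rightarrow> (forest \<Rightarrow> real \<Rightarrow> 'a::euclidean_space) \<Rightarrow> bool" where
  "controlled_rough_path N \<gamma> X J Y \<longleftrightarrow>
     (\<forall>f \<in> forests_upto (N - 1). \<forall>a b. {a..b} \<subseteq> J \<longrightarrow>
        (\<exists>C. \<forall>s t. a \<le> s \<and> s < t \<and> t \<le> b \<longrightarrow>
           norm (remainder N X Y f s t)
             / \<bar>t - s\<bar> powr ((real N - real (vertices f)) * \<gamma>) \<le> C))"

text \<open>\<open>iterated_derivative \<phi> [v\<^sub>1, \<dots>, v\<^sub>k] y\<close> is \<open>D\<^sup>k\<phi>(y)[v\<^sub>1, \<dots>, v\<^sub>k]\<close>, the derivative at \<open>y\<close> in
  direction \<open>v\<^sub>1\<close> of the map \<open>D\<^sup>k\<^sup>-\<^sup>1\<phi>(\<cdot>)[v\<^sub>2, \<dots>, v\<^sub>k]\<close>.\<close>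

primrec iterated_derivative ::
  "('a::real_normed_vector \<Rightarrow> 'b::real_normed_vector) \<Rightarrow> 'a list \<Rightarrow> 'a \<Rightarrow> 'b" where
  "iterated_derivative \<phi> [] = \<phi>"
| "iterated_derivative \<phi> (v # vs) =
     (\<lambda>y. frechet_derivative (iterated_derivative \<phi> vs) (at y) v)"

text \<open>The components \<open>\<partial>\<^sup>f \<phi>(Y)\<close>; \<open>permutations_of_multiset f\<close> is the set of ordered tuples of
  trees whose product is \<open>f\<close>.\<close>

definition compose_controlled ::
  "('a::euclidean_space \<Rightarrow> 'a) \<Rightarrow> (forest \<Rightarrow> real \<Rightarrow> 'a) \<Rightarrow> forest \<Rightarrow> real \<Rightarrow> 'a" where
  "compose_controlled \<phi> Y f t =
     (\<Sum>\<tau>s \<in> permutations_of_multiset f.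
        (1 / fact (size f)) *\<^sub>R iterated_derivative \<phi> (map (\<lambda>\<tau>. Y {#\<tau>#} t) \<tau>s) (Y {#} t))"

definition is_partition :: "real \<Rightarrow> real \<Rightarrow> real list \<Rightarrow> bool" where
  "is_partition s t P \<longleftrightarrow> P \<noteq> [] \<and> hd P = s \<and> last P = t \<and> sorted_wrt (<) P"

text \<open>The rough integral of \<open>\<phi>(Y)\<close> over \<open>[s, t]\<close> exists and equals \<open>I\<close>.
  The list \<open>zip P (tl P)\<close> consists of the consecutive pairs of points of \<open>P\<close>.\<close>

definition has_rough_integral ::
  "nat \<Rightarrow> (real \<Rightarrow> functional set) \<Rightarrow> ('a::euclidean_space \<Rightarrow> 'a)
    \<Rightarrow> (forest \<Rightarrow> real \<Rightarrow> 'a) \<Rightarrow> real \<Rightarrow> real \<Rightarrow> 'a \<Rightarrow> bool" where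
  "has_rough_integral N X \<phi> Y s t I \<longleftrightarrow>
     (\<forall>e>0. \<exists>d>0. \<forall>P. is_partition s t P \<and> (\<forall>(u, v) \<in> set (zip P (tl P)). v - u < d) \<longrightarrow>
        norm ((\<Sum>(u, v) \<leftarrow> zip P (tl P). \<Sum>f \<in> forests_upto (N - 1).
                 pairing (increment N X u v) (graft f) *\<^sub>R compose_controlled \<phi> Y f u) - I) < e)"


section \<open>Solutions and explosion\<close>

text \<open>The vector field \<open>\<phi>\<close> is defined on the open set \<open>U\<close>; a solution has to stay in \<open>U\<close>.\<close>

definition rde_solution ::
  "nat \<Rightarrow> real \<Rightarrow> (real \<Rightarrow> functional set) \<Rightarrow> 'a set \<Rightarrow> ('a::euclidean_space \<Rightarrow> 'a)
    \<Rightarrow> real set \<Rightarrow> (forest \<Rightarrow> real \<Rightarrow> 'a) \<Rightarrow> bool" where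
  "rde_solution N \<gamma> X U \<phi> J Y \<longleftrightarrow>
     controlled_rough_path N \<gamma> X J Y \<and>
     (\<forall>t \<in> J. Y {#} t \<in> U) \<and>
     (\<forall>t \<in> J. has_rough_integral N X \<phi> Y 0 t (Y {#} t - Y {#} 0)) \<and>
     (\<forall>f \<in> forests_upto (N - 2). \<forall>t \<in> J. Y (graft f) t = compose_controlled \<phi> Y f t) \<and>
     (\<forall>f \<in> forests_upto (N - 1). size f \<ge> 2 \<longrightarrow> (\<forall>t \<in> J. Y f t = 0))"

definition explodes_in_finite_time ::
  "nat \<Rightarrow> real \<Rightarrow> (real \<Rightarrow> functional set) \<Rightarrow> 'a set \<Rightarrow> ('a::euclidean_space \<Rightarrow> 'a)
    \<Rightarrow> 'a \<Rightarrow> bool" where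
  "explodes_in_finite_time N \<gamma> X U \<phi> y0 \<longleftrightarrow>
     (\<exists>\<xi>>0. \<exists>Y. rde_solution N \<gamma> X U \<phi> {0..<\<xi>} Y \<and> Y {#} 0 = y0 \<and>
        filterlim (\<lambda>t. norm (Y {#} t)) at_top (at_left \<xi>))"


section \<open>Regularity of real functions\<close>

definition Cb :: "nat \<Rightarrow> (real \<Rightarrow> real) set" where
  "Cb n = {f. (\<forall>j<n. \<forall>x. (deriv ^^ j) f field_differentiable at x) \<and>
              (\<forall>j\<le>n. continuous_on UNIV ((deriv ^^ j) f) \<and> bounded (range ((deriv ^^ j) f)))}"

end

theory Submission
  imports Defs
begin

text \<open>
  Write \<open>n = N - 1\<close> and \<open>T = [\<bullet>\<^sup>n]\<close>, a tree with \<open>N\<close> vertices. In degrees at most \<open>N\<close> the element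
  \<open>1 + c T\<close> differs from the unit only at \<open>T\<close>, in top degree, and of the terms in the coproduct of \<open>T\<close>
  two such elements detect just \<open>T \<otimes> 1\<close> and \<open>1 \<otimes> T\<close>. So they multiply by adding coefficients, and
  \<open>X\<^sub>s\<^sup>-\<^sup>1 \<star> X\<^sub>t = 1 + (t - s) T\<close> (\<open>pairing_increment\<close>). This has three consequences: \<open>X\<close> is a branched
  rough path as soon as \<open>N \<gamma> \<le> 1\<close> (\<open>branched_rough_path_one_plus\<close>); the remainders of a controlled
  path are plain increments, because only forests with fewer than \<open>N\<close> vertices occur in them
  (\<open>remainder_eq_increment\<close>), so any family of locally Lipschitz paths is controlled
  (\<open>controlled_rough_path_Lipschitz\<close>); and in the compensated sums only the forest \<open>\<bullet>\<^sup>n\<close> survives, so the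
  rough integral is the ordinary integral of \<open>\<partial>\<^sup>f \<phi>(Y)\<close> for \<open>f = \<bullet>\<^sup>n\<close>.

  On the axis \<open>x\<^sub>2 = 0\<close> the field is \<open>\<phi>(y, 0) = (0, y\<^sup>b)\<close> with \<open>b = 1/N - \<delta>\<close>; among the vertical
  derivatives of the first component up to order \<open>n\<close>, only the one of order \<open>n\<close> is nonzero, and it equals \<open>y\<^sup>a\<close> with
  \<open>a = 1/N + \<epsilon>\<close>. With \<open>\<partial>\<^sup>\<bullet> Y = \<phi>(Y)\<close> and all other proper derivatives zero, the components
  \<open>\<partial>\<^sup>f \<phi>(Y)\<close> therefore vanish for \<open>f \<noteq> 1, \<bullet>\<^sup>n\<close>, and the one at \<open>\<bullet>\<^sup>n\<close> is
  \<open>(y\<^sup>a (y\<^sup>b)\<^sup>n / n!, 0)\<close> (\<open>compose_controlled_along_axis\<close>). This points along the axis, so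
  \<open>Y = (y, 0)\<close> never leaves it, and the equation collapses to
  \<open>y' = y\<^sup>1\<^sup>+\<^sup>\<beta> / n!\<close>, \<open>y(0) = 1\<close>, where \<open>\<beta> = a + n b - 1 = \<epsilon> - n \<delta> > 0\<close>. Its solution
  \<open>y(t) = (1 - t/\<xi>)\<^sup>-\<^sup>1\<^sup>/\<^sup>\<beta>\<close> with \<open>\<xi> = n!/\<beta>\<close> blows up at time \<open>\<xi>\<close>.
\<close>

section \<open>Forests\<close>

text \<open>
  The recursion that defines the coproduct: \<open>graft\<close> reaches every tree, and sums of one-tree forests
  reach every forest.
\<close>

lemma forest_induct [case_names empty plus graft]:
  assumes "P {#}" "\<And>f g. P f \<Longrightarrow> P g \<Longrightarrow> P (f + g)" "\<And>f. P f \<Longrightarrow> P (graft f)"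
  shows "P (f :: forest)"
proof -
  have many: "P f" if "\<And>\<tau>. \<tau> \<in># f \<Longrightarrow> P {#\<tau>#}" for f
    using that by (induction f) (use assms in \<open>auto, metis add_mset_add_single\<close>)
  have "P {#\<tau>#}" for \<tau>
    by (induction \<tau>) (use many assms(3) in \<open>auto simp: graft_def\<close>)
  then show ?thesis using many by blast
qed

lemma vertices_plus: "vertices (f + g) = vertices f + vertices g"
  by (simp add: vertices_def)

lemma vertices_graft: "vertices (graft f) = Suc (vertices f)"
  by (simp add: vertices_def graft_def)

lemma tree_vertices_pos: "tree_vertices \<tau> > 0"
  by (cases \<tau>) simp

lemma vertices_eq_0_iff: "vertices f = 0 \<longleftrightarrow> f = {#}"
proof (cases f)
  case (add \<tau> h)
  then show ?thesis using tree_vertices_pos[of \<tau>] by (simp add: vertices_add)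
qed (simp add: vertices_def)

lemma size_le_vertices: "size f \<le> vertices f"
proof (induction f)
  case (add \<tau> f)
  then show ?case using tree_vertices_pos[of \<tau>] by (simp add: vertices_add)
qed simp

lemma tree_vertices_eq_1: "tree_vertices \<tau> = 1 \<Longrightarrow> \<tau> = bullet"
  by (cases \<tau>) (use vertices_eq_0_iff in \<open>auto simp: vertices_def bullet_def\<close>)

text \<open>
  The largest number of trees for a given number of vertices, which singles out \<open>\<bullet>\<^sup>n\<close> below.
\<close>

lemma vertices_eq_size: "vertices f = size f \<Longrightarrow> f = replicate_mset (size f) bullet"
proof (induction f)
  case (add \<tau> f)
  have "tree_vertices \<tau> = 1" "vertices f = size f"
    using add.prems tree_vertices_pos[of \<tau>] size_le_vertices[of f] by (simp_all add: vertices_add)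
  then show ?case using add.IH tree_vertices_eq_1 by auto
qed simp

lemma graft_eq_iff: "graft f = graft g \<longleftrightarrow> f = g"
  by (simp add: graft_def)

lemma graft_empty: "graft {#} = {#bullet#}"
  by (simp add: graft_def bullet_def)

section \<open>The coproduct and its unit parts\<close>

text \<open>
  A sum over a fixed index set, in which linearity becomes visible.
\<close>

lemma graft_right_superset:
  assumes "finite A" "Poly_Mapping.keys p \<subseteq> A"
  shows "graft_right p =
    (\<Sum>(g, h) \<in> A. Poly_Mapping.single (g, graft h) (Poly_Mapping.lookup p (g, h)))"
  unfolding graft_right_def
  by (rule sum.mono_neutral_left) (use assms in \<open>auto simp: in_keys_iff\<close>)

lemma graft_right_add: "graft_right (p + q) = graft_right p + graft_right q"
proof -
  let ?A = "Poly_Mapping.keys p \<union> Poly_Mapping.keys q"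
  have "Poly_Mapping.keys (p + q) \<subseteq> ?A" by (rule Poly_Mapping.keys_add)
  then show ?thesis
    by (subst (1 2 3) graft_right_superset[of ?A])
      (auto simp: lookup_add single_add case_prod_unfold sum.distrib)
qed

lemma graft_right_single:
  "graft_right (Poly_Mapping.single (g, h) c) = Poly_Mapping.single (g, graft h) c"
  by (subst graft_right_superset[of "{(g, h)}"]) auto

lemma keys_graft_right:
  "Poly_Mapping.keys (graft_right p) \<subseteq> (\<lambda>(g, h). (g, graft h)) ` Poly_Mapping.keys p"
  unfolding graft_right_def
  by (rule order_trans[OF keys_sum]) (auto split: if_splits)

lemma keys_coproduct:
  "(g, h) \<in> Poly_Mapping.keys (coproduct f) \<Longrightarrow> vertices g + vertices h = vertices f"
proof (induction f arbitrary: g h rule: forest_induct)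
  case empty
  then show ?case by (auto simp: coproduct_empty vertices_def)
next
  case (plus f1 f2)
  from plus.prems keys_mult[of "coproduct f1" "coproduct f2"] obtain a b c d
    where "(a, b) \<in> Poly_Mapping.keys (coproduct f1)"
      "(c, d) \<in> Poly_Mapping.keys (coproduct f2)" "(g, h) = (a, b) + (c, d)"
    unfolding coproduct_plus by fastforce
  then show ?case using plus.IH(1)[of a b] plus.IH(2)[of c d] by (simp add: vertices_plus)
next
  case (graft f)
  have "(g, h) \<in> {(graft f, {#})} \<union> Poly_Mapping.keys (graft_right (coproduct f))"
    using graft.prems keys_add unfolding coproduct_graft by fastforce
  then show ?case
  proof
    assume "(g, h) \<in> Poly_Mapping.keys (graft_right (coproduct f))"
    then obtain h' where "(g, h') \<in> Poly_Mapping.keys (coproduct f)" "h = graft h'"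
      using keys_graft_right by fastforce
    then show ?thesis using graft.IH[of g h'] by (simp add: vertices_graft)
  qed (simp add: vertices_def)
qed

text \<open>
  The part \<open>1 \<otimes> f\<close> of the coproduct. Splitting it off as a summand, with control on the keys of the
  rest, is stable under both multiplication and grafting; this avoids convolution sums.
\<close>

lemma coproduct_left_unit:
  "\<exists>p. coproduct f = Poly_Mapping.single ({#}, f) 1 + p \<and>
     (\<forall>(g, h) \<in> Poly_Mapping.keys p. g \<noteq> {#})"
proof (induction f rule: forest_induct)
  case empty
  show ?case by (rule exI[of _ 0]) (simp add: coproduct_empty)
next
  case (plus f1 f2)
  then obtain p q where p: "coproduct f1 = Poly_Mapping.single ({#}, f1) 1 + p"
      "\<forall>(g, h) \<in> Poly_Mapping.keys p. g \<noteq> {#}"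
    and q: "coproduct f2 = Poly_Mapping.single ({#}, f2) 1 + q"
      "\<forall>(g, h) \<in> Poly_Mapping.keys q. g \<noteq> {#}" by auto
  define r where "r = Poly_Mapping.single ({#}, f1) 1 * q + p * coproduct f2"
  have "coproduct (f1 + f2) = Poly_Mapping.single ({#}, f1 + f2) 1 + r"
    unfolding coproduct_plus r_def p(1) by (simp add: q(1) algebra_simps mult_single)
  moreover have "\<forall>(g, h) \<in> Poly_Mapping.keys r. g \<noteq> {#}"
    using p(2) q(2) keys_add[of "Poly_Mapping.single ({#}, f1) 1 * q" "p * coproduct f2"]
      keys_mult[of "Poly_Mapping.single ({#}, f1) (1::real)" q] keys_mult[of p "coproduct f2"]
    unfolding r_def by fastforce
  ultimately show ?case by blast
next
  case (graft f)
  then obtain p where p: "coproduct f = Poly_Mapping.single ({#}, f) 1 + p"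
      "\<forall>(g, h) \<in> Poly_Mapping.keys p. g \<noteq> {#}" by auto
  define r where "r = Poly_Mapping.single (graft f, {#}) 1 + graft_right p"
  have "coproduct (graft f) = Poly_Mapping.single ({#}, graft f) 1 + r"
    unfolding coproduct_graft r_def p(1)
    by (simp add: graft_right_add graft_right_single algebra_simps)
  moreover have "\<forall>(g, h) \<in> Poly_Mapping.keys r. g \<noteq> {#}"
    using p(2) keys_add[of "Poly_Mapping.single (graft f, {#}) 1" "graft_right p"]
      keys_graft_right[of p]
    unfolding r_def by (fastforce simp: graft_def)
  ultimately show ?case by blast
qed

text \<open>
  The part \<open>f \<otimes> 1\<close>. For trees it comes from the first summand of the recursion, because every
  right factor in the second one is a grafted forest, hence nonempty.
\<close>

lemma coproduct_right_unit:
  "\<exists>p. coproduct f = Poly_Mapping.single (f, {#}) 1 + p \<and>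
     (\<forall>(g, h) \<in> Poly_Mapping.keys p. h \<noteq> {#})"
proof (induction f rule: forest_induct)
  case empty
  show ?case by (rule exI[of _ 0]) (simp add: coproduct_empty)
next
  case (plus f1 f2)
  then obtain p q where p: "coproduct f1 = Poly_Mapping.single (f1, {#}) 1 + p"
      "\<forall>(g, h) \<in> Poly_Mapping.keys p. h \<noteq> {#}"
    and q: "coproduct f2 = Poly_Mapping.single (f2, {#}) 1 + q"
      "\<forall>(g, h) \<in> Poly_Mapping.keys q. h \<noteq> {#}" by auto
  define r where "r = Poly_Mapping.single (f1, {#}) 1 * q + p * coproduct f2"
  have "coproduct (f1 + f2) = Poly_Mapping.single (f1 + f2, {#}) 1 + r"
    unfolding coproduct_plus r_def p(1) by (simp add: q(1) algebra_simps mult_single)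
  moreover have "\<forall>(g, h) \<in> Poly_Mapping.keys r. h \<noteq> {#}"
    using p(2) q(2) keys_add[of "Poly_Mapping.single (f1, {#}) 1 * q" "p * coproduct f2"]
      keys_mult[of "Poly_Mapping.single (f1, {#}) (1::real)" q] keys_mult[of p "coproduct f2"]
    unfolding r_def by fastforce
  ultimately show ?case by blast
next
  case (graft f)
  have "\<forall>(g, h) \<in> Poly_Mapping.keys (graft_right (coproduct f)). h \<noteq> {#}"
    using keys_graft_right[of "coproduct f"] by (fastforce simp: graft_def)
  then show ?case using coproduct_graft by blast
qed

lemma lookup_coproduct_left: "Poly_Mapping.lookup (coproduct f) ({#}, h) = (if h = f then 1 else 0)"
proof -
  obtain p where p: "coproduct f = Poly_Mapping.single ({#}, f) 1 + p"
    and "\<forall>(g, h) \<in> Poly_Mapping.keys p. g \<noteq> {#}"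
    using coproduct_left_unit[of f] by blast
  then have "({#}, h) \<notin> Poly_Mapping.keys p" by blast
  then have "Poly_Mapping.lookup p ({#}, h) = 0" by (simp add: in_keys_iff)
  then show ?thesis unfolding p by (simp add: lookup_add lookup_single when_def)
qed

lemma lookup_coproduct_right: "Poly_Mapping.lookup (coproduct f) (g, {#}) = (if g = f then 1 else 0)"
proof -
  obtain p where p: "coproduct f = Poly_Mapping.single (f, {#}) 1 + p"
    and "\<forall>(g, h) \<in> Poly_Mapping.keys p. h \<noteq> {#}"
    using coproduct_right_unit[of f] by blast
  then have "(g, {#}) \<notin> Poly_Mapping.keys p" by blast
  then have "Poly_Mapping.lookup p (g, {#}) = 0" by (simp add: in_keys_iff)
  then show ?thesis unfolding p by (simp add: lookup_add lookup_single when_def)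
qed

section \<open>The product of characters\<close>

lemma tensor_pairing_superset:
  assumes "finite A" "Poly_Mapping.keys p \<subseteq> A"
  shows "tensor_pairing x y p = (\<Sum>(g, h) \<in> A. Poly_Mapping.lookup p (g, h) * (x g * y h))"
  unfolding tensor_pairing_def
  by (rule sum.mono_neutral_left) (use assms in \<open>auto simp: in_keys_iff\<close>)

lemma tensor_pairing_add: "tensor_pairing x y (p + q) = tensor_pairing x y p + tensor_pairing x y q"
proof -
  let ?A = "Poly_Mapping.keys p \<union> Poly_Mapping.keys q"
  have "Poly_Mapping.keys (p + q) \<subseteq> ?A" by (rule Poly_Mapping.keys_add)
  then show ?thesis
    by (subst (1 2 3) tensor_pairing_superset[of ?A])
      (auto simp: lookup_add algebra_simps case_prod_unfold sum.distrib)
qed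

lemma tensor_pairing_single: "tensor_pairing x y (Poly_Mapping.single (g, h) c) = c * (x g * y h)"
  by (subst tensor_pairing_superset[of "{(g, h)}"]) auto

lemma tensor_pairing_zero: "tensor_pairing x y 0 = 0"
  by (simp add: tensor_pairing_def)

lemma poly_mapping_single_induct [case_names zero single add]:
  fixes p :: "'a \<Rightarrow>\<^sub>0 'b::comm_monoid_add"
  assumes "P 0" "\<And>k v. P (Poly_Mapping.single k v)" "\<And>p q. P p \<Longrightarrow> P q \<Longrightarrow> P (p + q)"
  shows "P p"
proof (induction p rule: Poly_Mapping.update_induct)
  case (update p k v)
  have "Poly_Mapping.update k v p = p + Poly_Mapping.single k v"
    using update(1)
    by (intro poly_mapping_eqI) (auto simp: lookup_update lookup_add lookup_single when_def in_keys_iff)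
  then show ?case using assms(3)[OF update(3) assms(2)] by simp
qed (rule assms)

text \<open>
  The tensor product of two characters is a character of the tensor square. By bilinearity it
  suffices to compare the two sides on pairs of forests.
\<close>

lemma tensor_pairing_mult:
  assumes "is_character x" "is_character y"
  shows "tensor_pairing x y (p * q) = tensor_pairing x y p * tensor_pairing x y q"
proof -
  have single_q: "tensor_pairing x y (Poly_Mapping.single k v * q) =
      tensor_pairing x y (Poly_Mapping.single k v) * tensor_pairing x y q" for k v q
  proof (induction q rule: poly_mapping_single_induct)
    case (single l w)
    obtain a b c d where [simp]: "k = (a, b)" "l = (c, d)" by fastforce
    show ?case using assms
      by (simp add: mult_single tensor_pairing_single is_character_def algebra_simps)
  qed (simp_all add: distrib_left tensor_pairing_add tensor_pairing_zero)
  show ?thesis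
    by (induction p rule: poly_mapping_single_induct)
      (simp_all add: single_q distrib_right tensor_pairing_add tensor_pairing_zero)
qed

lemma is_character_star:
  assumes "is_character x" "is_character y"
  shows "is_character (star x y)"
  using assms tensor_pairing_mult[OF assms]
  by (simp add: is_character_def star_def coproduct_plus coproduct_empty tensor_pairing_single)

text \<open>
  The coproduct preserves the number of vertices, so the product in degree \<open>k\<close> depends only on the
  factors in degrees up to \<open>k\<close>. Hence it passes to the quotient \<open>G\<^sub>N\<close>.
\<close>

lemma star_cong:
  assumes "\<And>g. vertices g \<le> vertices f \<Longrightarrow> x g = x' g"
    and "\<And>h. vertices h \<le> vertices f \<Longrightarrow> y h = y' h"
  shows "star x y f = star x' y' f"
  unfolding star_def tensor_pairing_def
proof (rule sum.cong[OF refl], clarify)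
  fix g h assume "(g, h) \<in> Poly_Mapping.keys (coproduct f)"
  from keys_coproduct[OF this] have "x g = x' g" "y h = y' h" using assms by simp_all
  then show "Poly_Mapping.lookup (coproduct f) (g, h) * (x g * y h) =
    Poly_Mapping.lookup (coproduct f) (g, h) * (x' g * y' h)" by simp
qed

lemma equiv_agree_upto: "equiv {x. is_character x} (agree_upto N)"
  by (rule equivI) (auto simp: agree_upto_def refl_on_def sym_def trans_def)

lemma mult_G:
  assumes "is_character x" "is_character y"
  shows "(agree_upto N `` {x}) \<otimes>\<^bsub>G N\<^esub> (agree_upto N `` {y}) = agree_upto N `` {star x y}"
proof -
  have xy: "(x, x) \<in> agree_upto N" "(y, y) \<in> agree_upto N"
    using assms by (auto simp: agree_upto_def)
  have const: "agree_upto N `` {star x' y'} = agree_upto N `` {star x y}"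
    if xx': "(x, x') \<in> agree_upto N" and yy': "(y, y') \<in> agree_upto N" for x' y'
  proof (rule equiv_class_eq[OF equiv_agree_upto])
    have "star x' y' f = star x y f" if "f \<in> forests_upto N" for f
      by (rule star_cong) (use that xx' yy' in \<open>auto simp: agree_upto_def forests_upto_def\<close>)
    then show "(star x' y', star x y) \<in> agree_upto N"
      using xx' yy' by (simp add: agree_upto_def is_character_star)
  qed
  have inner: "(\<Union>y'\<in>agree_upto N `` {y}. agree_upto N `` {star x' y'}) = agree_upto N `` {star x y}"
    if "x' \<in> agree_upto N `` {x}" for x'
  proof (rule SUP_eq_const)
    show "agree_upto N `` {y} \<noteq> {}" using xy by blast
    show "agree_upto N `` {star x' y'} = agree_upto N `` {star x y}" if "y' \<in> agree_upto N `` {y}" for y'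
      by (rule const) (use that \<open>x' \<in> _\<close> in blast)+
  qed
  have "(\<Union>x'\<in>agree_upto N `` {x}. \<Union>y'\<in>agree_upto N `` {y}. agree_upto N `` {star x' y'}) =
      agree_upto N `` {star x y}"
    by (rule SUP_eq_const) (use xy inner in blast)+
  then show ?thesis by (simp add: G_def)
qed

section \<open>Increments of the path\<close>

text \<open>
  The functional represents \<open>1 + c T\<close> in \<open>G\<^sub>N\<close>.
\<close>

definition one_plus :: "nat \<Rightarrow> forest \<Rightarrow> real \<Rightarrow> functional \<Rightarrow> bool" where
  "one_plus N T c x \<longleftrightarrow> is_character x \<and>
     (\<forall>f \<in> forests_upto N. x f = (if f = {#} then 1 else if f = T then c else 0))"

text \<open>
  In the coproduct of a forest with at most \<open>N\<close> vertices, \<open>1 + c T\<close> sees only left factors \<open>1\<close> and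
  \<open>T\<close>. The right factor belonging to \<open>T\<close> has no vertices left, and the term \<open>T \<otimes> 1\<close> occurs only
  in the coproduct of \<open>T\<close> itself. Stated for arbitrary functionals, it covers both group products and
  the pairings in the remainder of a controlled path.
\<close>

lemma star_one_plus:
  assumes T: "vertices T = N" "T \<noteq> {#}"
    and x: "\<forall>f \<in> forests_upto N. x f = (if f = {#} then 1 else if f = T then c else 0)"
    and f: "f \<in> forests_upto N"
  shows "star x y f = y f + (if f = T then c * y {#} else 0)"
proof -
  let ?K = "Poly_Mapping.keys (coproduct f)"
  have zero: "Poly_Mapping.lookup (coproduct f) (g, h) * (x g * y h) = 0"
    if k: "(g, h) \<in> ?K" and n: "(g, h) \<noteq> ({#}, f)" "(g, h) \<noteq> (T, {#})" for g h
  proof -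
    have v: "vertices g + vertices h = vertices f" by (rule keys_coproduct[OF k])
    consider "g = {#}" | "g = T" | "g \<noteq> {#}" "g \<noteq> T" by blast
    then show ?thesis
    proof cases
      case 1
      then show ?thesis using n by (simp add: lookup_coproduct_left)
    next
      case 2
      then have "vertices h = 0" using v T f by (simp add: forests_upto_def)
      then show ?thesis using n 2 by (simp add: vertices_eq_0_iff)
    next
      case 3
      then have "x g = 0" using v x f by (auto simp: forests_upto_def)
      then show ?thesis by simp
    qed
  qed
  have "star x y f = (\<Sum>(g, h) \<in> ?K \<union> {({#}, f), (T, {#})}.
      Poly_Mapping.lookup (coproduct f) (g, h) * (x g * y h))"
    unfolding star_def by (rule tensor_pairing_superset) auto
  also have "\<dots> = (\<Sum>(g, h) \<in> {({#}, f), (T, {#})}.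
      Poly_Mapping.lookup (coproduct f) (g, h) * (x g * y h))"
    by (rule sum.mono_neutral_right) (use zero in fastforce)+
  also have "\<dots> = x {#} * y f + (if f = T then x T * y {#} else 0)"
    using T(2) by (auto simp: lookup_coproduct_left lookup_coproduct_right)
  also have "\<dots> = y f + (if f = T then c * y {#} else 0)"
    using x T by (auto simp: forests_upto_def vertices_def)
  finally show ?thesis .
qed

lemma one_plus_star:
  assumes "vertices T = N" "T \<noteq> {#}" "one_plus N T c x" "one_plus N T d y"
  shows "one_plus N T (c + d) (star x y)"
  using assms star_one_plus[OF assms(1,2), of x c _ y] is_character_star[of x y]
  by (auto simp: one_plus_def forests_upto_def vertices_def)

lemma one_plus_unique:
  assumes "one_plus N T c x" "one_plus N T c y"
  shows "agree_upto N `` {x} = agree_upto N `` {y}"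
  using assms by (intro equiv_class_eq[OF equiv_agree_upto]) (auto simp: one_plus_def agree_upto_def)

lemma one_plus_counit: "one_plus N T 0 (dual_forest {#})"
  by (auto simp: one_plus_def dual_forest_def is_character_def)

text \<open>
  The inverse in \<open>G\<^sub>N\<close> is a definite description, so uniqueness is part of the claim. It follows without
  associativity, since by \<open>star_one_plus\<close> the equation \<open>(1 + c T) \<star> b = 1\<close> determines \<open>b\<close>
  on all forests with at most \<open>N\<close> vertices.
\<close>

lemma one_plus_inverse:
  assumes T: "vertices T = N" "T \<noteq> {#}" and x: "one_plus N T c x" and y: "one_plus N T (- c) y"
  shows "inv\<^bsub>G N\<^esub> (agree_upto N `` {x}) = agree_upto N `` {y}"
  unfolding m_inv_def
proof (rule the_equality)
  have xy: "is_character x" "is_character y" using x y by (simp_all add: one_plus_def)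
  have one: "\<one>\<^bsub>G N\<^esub> = agree_upto N `` {dual_forest {#}}" by (simp add: G_def)
  show "agree_upto N `` {y} \<in> carrier (G N) \<and>
      agree_upto N `` {x} \<otimes>\<^bsub>G N\<^esub> agree_upto N `` {y} = \<one>\<^bsub>G N\<^esub> \<and>
      agree_upto N `` {y} \<otimes>\<^bsub>G N\<^esub> agree_upto N `` {x} = \<one>\<^bsub>G N\<^esub>"
    using one_plus_unique[OF one_plus_star[OF T x y]] one_plus_unique[OF one_plus_star[OF T y x]]
      one_plus_counit[of N T] xy by (auto simp: mult_G one) (auto simp: G_def quotient_def)
  fix B assume B: "B \<in> carrier (G N) \<and>
      agree_upto N `` {x} \<otimes>\<^bsub>G N\<^esub> B = \<one>\<^bsub>G N\<^esub> \<and> B \<otimes>\<^bsub>G N\<^esub> agree_upto N `` {x} = \<one>\<^bsub>G N\<^esub>"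
  then obtain b where b: "is_character b" "B = agree_upto N `` {b}"
    by (auto simp: G_def quotient_def)
  have "agree_upto N `` {star x b} = agree_upto N `` {dual_forest {#}}"
    using B b xy by (simp add: mult_G one)
  then have "(star x b, dual_forest {#}) \<in> agree_upto N"
    by (rule eq_equiv_class[OF _ equiv_agree_upto])
      (use one_plus_counit in \<open>auto simp: one_plus_def\<close>)
  moreover have "star x b f = b f + (if f = T then c else 0)" if "f \<in> forests_upto N" for f
    using star_one_plus[OF T, of x c f b] x b(1) that by (simp add: one_plus_def is_character_def)
  ultimately have "\<forall>f\<in>forests_upto N. b f + (if f = T then c else 0) = dual_forest {#} f"
    by (auto simp: agree_upto_def)
  then have "one_plus N T (- c) b" using b(1) T
    by (auto simp: one_plus_def dual_forest_def split: if_splits)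
  then show "B = agree_upto N `` {y}" using b(2) y one_plus_unique by blast
qed

lemma corolla_nonempty: "corolla n \<noteq> {#}"
  by (simp add: corolla_def graft_def)

lemma pairing_increment:
  assumes N: "N \<ge> 2"
    and X: "\<And>t. t \<ge> 0 \<Longrightarrow> X t \<in> carrier (G N)"
      "\<And>t. t \<ge> 0 \<Longrightarrow> pairing (X t) {#} = 1"
      "\<And>t. t \<ge> 0 \<Longrightarrow> pairing (X t) (corolla (N - 1)) = t"
      "\<And>t h. t \<ge> 0 \<Longrightarrow> h \<in> forests_upto N \<Longrightarrow> h \<noteq> {#} \<Longrightarrow> h \<noteq> corolla (N - 1) \<Longrightarrow>
        pairing (X t) h = 0"
    and st: "s \<ge> 0" "t \<ge> 0" and f: "f \<in> forests_upto N"
  shows "pairing (increment N X s t) f =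
    (if f = {#} then 1 else if f = corolla (N - 1) then t - s else 0)"
proof -
  define T where "T = corolla (N - 1)"
  have T: "vertices T = N" "T \<noteq> {#}"
    using N by (simp_all add: T_def vertices_corolla corolla_nonempty)
  have rep: "\<exists>x. A = agree_upto N `` {x} \<and> one_plus N T c x"
    if A: "A \<in> carrier (G N)" and p: "pairing A {#} = 1" "pairing A T = c"
      "\<forall>h \<in> forests_upto N. h \<noteq> {#} \<and> h \<noteq> T \<longrightarrow> pairing A h = 0" for A c
  proof -
    obtain x where x: "is_character x" "A = agree_upto N `` {x}"
      using A by (auto simp: G_def quotient_def)
    then have "one_plus N T c x"
      using p pairing_class[OF x(1), of _ N] by (auto simp: one_plus_def)
    then show ?thesis using x by blast
  qed
  have "\<exists>x. X r = agree_upto N `` {x} \<and> one_plus N T r x" if "r \<ge> 0" for r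
    using rep[of "X r" r] X[OF that] unfolding T_def by blast
  then obtain x y where x: "X s = agree_upto N `` {x}" "one_plus N T s x"
    and y: "X t = agree_upto N `` {y}" "one_plus N T t y" using st by blast
  obtain z where z: "one_plus N T (- s) z"
    using exists_corolla_element[OF N, of "- s"] rep[of _ "- s"] unfolding T_def by meson
  have zy: "one_plus N T (- s + t) (star z y)" by (rule one_plus_star[OF T z y(2)])
  have "increment N X s t = agree_upto N `` {star z y}"
    unfolding increment_def x(1) y(1) one_plus_inverse[OF T x(2) z]
    by (rule mult_G) (use z y in \<open>simp_all add: one_plus_def\<close>)
  then show ?thesis
    using pairing_class[of "star z y" f N] zy f by (simp add: one_plus_def T_def)
qed

section \<open>Hoelder bounds and controlled paths\<close>

lemma Lipschitz_divide_powr: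
  fixes r L a D :: real
  assumes "r \<le> L * (t - s)" "0 \<le> L" "s < t" "t - s \<le> D" "a \<le> 1"
  shows "r / \<bar>t - s\<bar> powr a \<le> L * D powr (1 - a)"
proof -
  have "r / \<bar>t - s\<bar> powr a \<le> L * (t - s) / (t - s) powr a"
    using assms by (simp add: divide_right_mono)
  also have "\<dots> = L * (t - s) powr (1 - a)"
    using assms by (simp add: powr_diff)
  also have "\<dots> \<le> L * D powr (1 - a)"
    using assms by (intro mult_left_mono powr_mono2) auto
  finally show ?thesis .
qed

lemma C1_imp_Lipschitz:
  fixes y F :: "real \<Rightarrow> real"
  assumes y: "\<And>r. a \<le> r \<Longrightarrow> r \<le> b \<Longrightarrow> (y has_real_derivative F r) (at r)"
    and F: "continuous_on {a..b} F"
  shows "\<exists>L\<ge>0. \<forall>s t. a \<le> s \<and> s < t \<and> t \<le> b \<longrightarrow> \<bar>y t - y s\<bar> \<le> L * (t - s)"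
proof -
  have "bounded (F ` {a..b})"
    by (intro compact_imp_bounded compact_continuous_image F) simp
  then obtain L where L: "L > 0" "\<And>r. r \<in> {a..b} \<Longrightarrow> \<bar>F r\<bar> \<le> L"
    unfolding bounded_pos by auto
  have "\<bar>y t - y s\<bar> \<le> L * (t - s)" if st: "a \<le> s" "s < t" "t \<le> b" for s t
  proof -
    obtain z where z: "s < z" "z < t" "y t - y s = (t - s) * F z"
      using MVT2[OF st(2), of y F] y st by auto
    then show ?thesis using L(2)[of z] st by (simp add: abs_mult mult.commute)
  qed
  then show ?thesis using L(1) by (intro exI[of _ L]) auto
qed

text \<open>
  On bounded intervals the component \<open>t - s\<close> at \<open>T\<close> is of order \<open>(t - s)\<^sup>N\<^sup>\<gamma>\<close> because \<open>N \<gamma> \<le> 1\<close>.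
\<close>

lemma branched_rough_path_one_plus:
  assumes X: "\<And>t. t \<ge> 0 \<Longrightarrow> X t \<in> carrier (G N)"
    and T: "vertices T = N" "N > 0" and \<gamma>: "\<gamma> \<le> 1 / real N"
    and inc: "\<And>s t f. s \<ge> 0 \<Longrightarrow> t \<ge> 0 \<Longrightarrow> f \<in> forests_upto N \<Longrightarrow>
      pairing (increment N X s t) f = (if f = {#} then 1 else if f = T then t - s else 0)"
  shows "branched_rough_path N \<gamma> S X"
  unfolding branched_rough_path_def
proof (intro conjI ballI)
  fix f assume f: "f \<in> forests_upto N"
  consider "f = {#}" | "f = T" "f \<noteq> {#}" | "f \<noteq> T" "f \<noteq> {#}" by blast
  then show "\<exists>C. \<forall>s t. 0 \<le> s \<and> s < t \<and> t \<le> S \<longrightarrow>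
      \<bar>pairing (increment N X s t) f\<bar> / \<bar>t - s\<bar> powr (\<gamma> * real (vertices f)) \<le> C"
  proof cases
    case 1
    then show ?thesis using inc f by (intro exI[of _ 1]) (auto simp: vertices_def)
  next
    case 2
    have "\<gamma> * real (vertices f) \<le> 1" using \<gamma> T 2 by (simp add: field_simps)
    then have "\<bar>t - s\<bar> / \<bar>t - s\<bar> powr (\<gamma> * real (vertices f))
        \<le> 1 * S powr (1 - \<gamma> * real (vertices f))" if "0 \<le> s" "s < t" "t \<le> S" for s t
      using that by (intro Lipschitz_divide_powr) auto
    then show ?thesis using inc f 2 by (intro exI[of _ "1 * S powr (1 - \<gamma> * real (vertices f))"]) auto
  next
    case 3
    then show ?thesis using inc f by (intro exI[of _ 0]) auto
  qed
qed (use X in auto)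

text \<open>
  Forests in the sum have fewer than \<open>N\<close> vertices, where the increment of the driving path coincides
  with the counit; pairing the coproduct with the counit on the left gives back the forest.
\<close>

lemma remainder_eq_increment:
  fixes Y :: "forest \<Rightarrow> real \<Rightarrow> 'a::euclidean_space"
  assumes T: "vertices T = N" "N > 0"
    and X: "\<And>f. f \<in> forests_upto N \<Longrightarrow> pairing (increment N X s t) f =
      (if f = {#} then 1 else if f = T then c else 0)"
    and f: "f \<in> forests_upto (N - 1)"
  shows "remainder N X Y f s t = Y f t - Y f s"
proof -
  have "tensor_pairing (pairing (increment N X s t)) (dual_forest f) (coproduct g) = (if g = f then 1 else 0)"
    if g: "g \<in> forests_upto (N - 1)" for g
  proof -
    have "g \<in> forests_upto N" "g \<noteq> T" "T \<noteq> {#}"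
      using g T by (auto simp: forests_upto_def vertices_def)
    then show ?thesis
      using star_one_plus[of T N "pairing (increment N X s t)" c g "dual_forest f"] X T
      by (simp add: star_def dual_forest_def)
  qed
  then have "(\<Sum>g \<in> forests_upto (N - 1).
      tensor_pairing (pairing (increment N X s t)) (dual_forest f) (coproduct g) *\<^sub>R Y g s) =
      (\<Sum>g \<in> forests_upto (N - 1). if g = f then Y g s else 0)"
    by (intro sum.cong refl) simp
  also have "\<dots> = Y f s" using f finite_forests_upto by simp
  finally show ?thesis by (simp add: remainder_def)
qed

text \<open>
  Lipschitz bounds suffice because the required exponents \<open>(N - |f|) \<gamma>\<close> are at most \<open>N \<gamma> \<le> 1\<close>.
\<close>

lemma controlled_rough_path_Lipschitz:
  fixes Y :: "forest \<Rightarrow> real \<Rightarrow> 'a::euclidean_space"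
  assumes \<gamma>: "0 < \<gamma>" "\<gamma> \<le> 1 / real N" and N: "N > 0"
    and R: "\<And>f s t. f \<in> forests_upto (N - 1) \<Longrightarrow> s \<in> J \<Longrightarrow> t \<in> J \<Longrightarrow>
      remainder N X Y f s t = Y f t - Y f s"
    and L: "\<And>f a b. f \<in> forests_upto (N - 1) \<Longrightarrow> {a..b} \<subseteq> J \<Longrightarrow>
      \<exists>L\<ge>0. \<forall>s t. a \<le> s \<and> s < t \<and> t \<le> b \<longrightarrow> norm (Y f t - Y f s) \<le> L * (t - s)"
  shows "controlled_rough_path N \<gamma> X J Y"
  unfolding controlled_rough_path_def
proof (intro ballI allI impI)
  fix f and a b :: real assume f: "f \<in> forests_upto (N - 1)" and ab: "{a..b} \<subseteq> J"
  obtain L where L: "L \<ge> 0"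
      "\<And>s t. a \<le> s \<and> s < t \<and> t \<le> b \<Longrightarrow> norm (Y f t - Y f s) \<le> L * (t - s)"
    using L[OF f ab] by blast
  let ?p = "(real N - real (vertices f)) * \<gamma>"
  have "?p \<le> real N * \<gamma>" using \<gamma> by (intro mult_right_mono) auto
  also have "\<dots> \<le> 1" using \<gamma> N by (simp add: field_simps)
  finally have p: "?p \<le> 1" .
  have "norm (remainder N X Y f s t) / \<bar>t - s\<bar> powr ?p \<le> L * (b - a) powr (1 - ?p)"
    if st: "a \<le> s \<and> s < t \<and> t \<le> b" for s t
  proof -
    have "s \<in> J" "t \<in> J" using st ab by (auto simp: subset_iff)
    then show ?thesis unfolding R[OF f \<open>s \<in> J\<close> \<open>t \<in> J\<close>]
      by (intro Lipschitz_divide_powr L p) (use st in auto)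
  qed
  then show "\<exists>C. \<forall>s t. a \<le> s \<and> s < t \<and> t \<le> b \<longrightarrow>
      norm (remainder N X Y f s t) / \<bar>t - s\<bar> powr ?p \<le> C" by blast
qed

section \<open>Vertical derivatives of the vector field\<close>

lemma vector_2_alt: "(vector [a, b] :: real ^ 2) = a *\<^sub>R axis 1 1 + b *\<^sub>R axis 2 1"
  by (simp add: vec_eq_iff forall_2 vector_2 axis_def)

lemma norm_vector_2_fst: "norm (vector [a, 0] :: real ^ 2) = \<bar>a\<bar>"
  by (simp add: vector_2_alt)

lemma norm_vector_2_snd: "norm (vector [0, b] :: real ^ 2) = \<bar>b\<bar>"
  by (simp add: vector_2_alt)

lemma has_derivative_powr_times:
  fixes x :: "real ^ 2"
  assumes "x $ 1 > 0" "h field_differentiable at (x $ 2)"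
  shows "\<exists>D. ((\<lambda>y. y $ 1 powr a * h (y $ 2)) has_derivative D) (at x) \<and>
    (\<forall>c. D (c *\<^sub>R axis 2 1) = c * (x $ 1 powr a * deriv h (x $ 2)))"
proof -
  have nth: "((\<lambda>y::real^2. y $ i) has_derivative (\<lambda>v. v $ i)) (at x)" for i
    by (rule bounded_linear_imp_has_derivative[OF bounded_linear_vec_nth])
  have h: "(h has_derivative (*) (deriv h (x $ 2))) (at (x $ 2))"
    using field_differentiable_derivI[OF assms(2)] by (simp add: has_field_derivative_def)
  have p: "((\<lambda>r. r powr a) has_derivative (*) (a * x $ 1 powr (a - 1))) (at (x $ 1))"
    using has_real_derivative_powr[OF assms(1), of a] by (simp add: has_field_derivative_def)
  have "((\<lambda>y. y $ 1 powr a * h (y $ 2)) has_derivative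
      (\<lambda>v. x $ 1 powr a * (deriv h (x $ 2) * v $ 2) + a * x $ 1 powr (a - 1) * v $ 1 * h (x $ 2))) (at x)"
    by (rule has_derivative_mult[OF has_derivative_compose[OF nth p] has_derivative_compose[OF nth h]])
  then show ?thesis by (intro exI conjI) (auto simp: axis_def)
qed

text \<open>
  Differentiating along the second axis acts only on the factors that depend on the second
  coordinate. The iterated derivative is built from Frechet derivatives at points, so the
  induction runs over the whole open half-plane and establishes differentiability on the way.
\<close>

lemma iterated_derivative_second_coordinate:
  fixes \<phi> :: "real ^ 2 \<Rightarrow> real ^ 2"
  assumes \<phi>: "\<And>x. x $ 1 > 0 \<Longrightarrow>
      \<phi> x = vector [x $ 1 powr a * h (x $ 2), x $ 1 powr b * k (x $ 2)]"
    and hk: "h \<in> Cb n" "k \<in> Cb n"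
    and x: "x $ 1 > 0" and cs: "length cs \<le> n"
  shows "iterated_derivative \<phi> (map (\<lambda>c. vector [0, c]) cs) x =
    prod_list cs *\<^sub>R vector [x $ 1 powr a * (deriv ^^ length cs) h (x $ 2),
                          x $ 1 powr b * (deriv ^^ length cs) k (x $ 2)]"
  using x cs
proof (induction cs arbitrary: x)
  case Nil
  then show ?case by (simp add: \<phi>)
next
  case (Cons c cs)
  let ?m = "length cs" and ?p = "prod_list cs"
  let ?H = "\<lambda>y::real^2. y $ 1 powr a * (deriv ^^ ?m) h (y $ 2)"
  let ?K = "\<lambda>y::real^2. y $ 1 powr b * (deriv ^^ ?m) k (y $ 2)"
  let ?F = "iterated_derivative \<phi> (map (\<lambda>c. vector [0, c]) cs)"
  have diff: "(deriv ^^ ?m) h field_differentiable at r" "(deriv ^^ ?m) k field_differentiable at r" for r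
    using hk Cons.prems(2) by (auto simp: Cb_def)
  obtain D where D: "(?H has_derivative D) (at x)"
      "\<And>c. D (c *\<^sub>R axis 2 1) = c * (x $ 1 powr a * (deriv ^^ Suc ?m) h (x $ 2))"
    using has_derivative_powr_times[OF Cons.prems(1) diff(1), of a] by auto
  obtain E where E: "(?K has_derivative E) (at x)"
      "\<And>c. E (c *\<^sub>R axis 2 1) = c * (x $ 1 powr b * (deriv ^^ Suc ?m) k (x $ 2))"
    using has_derivative_powr_times[OF Cons.prems(1) diff(2), of b] by auto
  have "((\<lambda>y. ?p *\<^sub>R (?H y *\<^sub>R axis 1 1 + ?K y *\<^sub>R axis 2 1)) has_derivative
      (\<lambda>v. ?p *\<^sub>R (D v *\<^sub>R axis 1 1 + E v *\<^sub>R axis 2 (1::real)))) (at x)"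
    by (intro has_derivative_scaleR_right has_derivative_add has_derivative_scaleR_left D(1) E(1))
  then have "(?F has_derivative (\<lambda>v. ?p *\<^sub>R (D v *\<^sub>R axis 1 1 + E v *\<^sub>R axis 2 1))) (at x)"
  proof (rule has_derivative_transform_within_open)
    show "open {y::real^2. y $ 1 > 0}" by (intro open_Collect_less continuous_intros)
    show "?p *\<^sub>R (?H y *\<^sub>R axis 1 1 + ?K y *\<^sub>R axis 2 1) = ?F y" if "y \<in> {y. y $ 1 > 0}" for y
      using Cons.IH[of y] Cons.prems(2) that by (simp add: vector_2_alt)
  qed (use Cons.prems in simp)
  then have "frechet_derivative ?F (at x) = (\<lambda>v. ?p *\<^sub>R (D v *\<^sub>R axis 1 1 + E v *\<^sub>R axis 2 1))"
    by (rule frechet_derivative_at[symmetric])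
  then show ?case by (simp add: D(2) E(2) vector_2_alt scaleR_right_distrib mult_ac)
qed

lemma sum_list_vector_2:
  "(\<Sum>(u, v) \<leftarrow> xs. (vector [g u v, 0] :: real ^ 2)) = vector [\<Sum>(u, v) \<leftarrow> xs. g u v, 0]"
  by (induction xs) (auto simp: vector_2_alt scaleR_add_left)

lemma permutations_of_replicate_mset:
  "permutations_of_multiset (replicate_mset n x) = {replicate n x}"
proof (intro equalityI subsetI)
  fix xs assume "xs \<in> permutations_of_multiset (replicate_mset n x)"
  then have m: "mset xs = replicate_mset n x" by (rule permutations_of_multisetD)
  have "set xs \<subseteq> {x}" "length xs = n"
    using arg_cong[OF m, of set_mset] arg_cong[OF m, of size] by (auto split: if_splits)
  then have "replicate (length xs) x = xs" by (intro replicate_length_same) auto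
  then show "xs \<in> {replicate n x}" using \<open>length xs = n\<close> by simp
qed (auto intro: permutations_of_multisetI)

text \<open>
  All directions \<open>\<partial>\<^sup>\<tau> Y\<close> are vertical, so only derivatives of the factors \<open>h\<close> and \<open>k\<close> at \<open>0\<close> enter. Forests
  with \<open>0 < #f < n\<close> meet vanishing derivatives of both factors, and \<open>#f = n\<close> forces \<open>f = \<bullet>\<^sup>n\<close>, as \<open>f\<close> has
  at most \<open>n\<close> vertices.
\<close>

lemma compose_controlled_along_axis:
  fixes \<phi> :: "real ^ 2 \<Rightarrow> real ^ 2" and Y :: "forest \<Rightarrow> real \<Rightarrow> real ^ 2"
  assumes n: "n \<ge> 1"
    and \<phi>: "\<And>x. x $ 1 > 0 \<Longrightarrow>
      \<phi> x = vector [x $ 1 powr a * h (x $ 2), x $ 1 powr b * k (x $ 2)]"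
    and Cb: "h \<in> Cb n" "k \<in> Cb n"
    and h: "\<And>j. j \<le> n \<Longrightarrow> (deriv ^^ j) h 0 = (if j = n then 1 else 0)"
    and k: "\<And>j. j \<le> n \<Longrightarrow> (deriv ^^ j) k 0 = (if j = 0 then 1 else 0)"
    and y: "y > 0" "Y {#} t = vector [y, 0]"
    and z: "\<And>\<tau>. Y {#\<tau>#} t = vector [0, if \<tau> = bullet then z else 0]"
    and f: "f \<in> forests_upto n"
  shows "compose_controlled \<phi> Y f t =
    (if f = {#} then vector [0, y powr b]
     else if f = replicate_mset n bullet then vector [y powr a * z ^ n / fact n, 0] else 0)"
proof -
  define c where "c = (\<lambda>\<tau>. if \<tau> = bullet then z else 0)"
  let ?m = "size f"
  have m: "?m \<le> n" using f size_le_vertices[of f] by (simp add: forests_upto_def)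
  have D: "iterated_derivative \<phi> (map (\<lambda>\<tau>. Y {#\<tau>#} t) \<tau>s) (Y {#} t) =
      prod_list (map c \<tau>s) *\<^sub>R vector [if ?m = n then y powr a else 0, if ?m = 0 then y powr b else 0]"
    if "\<tau>s \<in> permutations_of_multiset f" for \<tau>s
  proof -
    have len: "length \<tau>s = ?m" using permutations_of_multisetD[OF that] by auto
    have args: "map (\<lambda>\<tau>. Y {#\<tau>#} t) \<tau>s = map (\<lambda>c. vector [0, c]) (map c \<tau>s)"
      by (simp add: z c_def o_def)
    show ?thesis unfolding args
      using iterated_derivative_second_coordinate[OF \<phi> Cb, of "Y {#} t" "map c \<tau>s"] m len h[OF m] k[OF m]
      by (simp add: y vector_2 del: map_map)
  qed
  have sum: "compose_controlled \<phi> Y f t = (\<Sum>\<tau>s \<in> permutations_of_multiset f. (1 / fact ?m) *\<^sub>R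
      (prod_list (map c \<tau>s) *\<^sub>R vector [if ?m = n then y powr a else 0, if ?m = 0 then y powr b else 0]))"
    unfolding compose_controlled_def by (intro sum.cong refl) (simp add: D)
  consider "f = {#}" | "?m = n" "f \<noteq> {#}" | "?m \<noteq> n" "f \<noteq> {#}" by blast
  then show ?thesis
  proof cases
    case 1
    then show ?thesis using n sum by simp
  next
    case 2
    then have "vertices f = size f"
      using f size_le_vertices[of f] by (simp add: forests_upto_def)
    then have "f = replicate_mset n bullet" using vertices_eq_size 2 by metis
    then show ?thesis using 2 n unfolding sum
      by (simp add: permutations_of_replicate_mset c_def vector_2_alt prod_list_replicate)
  next
    case 3
    then have "f \<noteq> replicate_mset n bullet" by auto
    then show ?thesis using 3 unfolding sum by (simp add: vector_2_alt)
  qed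
qed

section \<open>Left Riemann sums\<close>

lemma is_partition_Cons_Cons:
  "is_partition s t (u # v # P) \<longleftrightarrow> u = s \<and> u < v \<and> is_partition v t (v # P)"
  by (auto simp: is_partition_def)

lemma is_partition_le: "is_partition s t P \<Longrightarrow> s \<le> t"
proof (induction P arbitrary: s)
  case (Cons u P)
  show ?case
  proof (cases P)
    case Nil
    then show ?thesis using Cons.prems by (simp add: is_partition_def)
  next
    case (Cons v Q)
    then show ?thesis using Cons.IH[of v] Cons.prems by (simp add: is_partition_Cons_Cons)
  qed
qed (simp add: is_partition_def)

lemma is_partition_bounds:
  assumes "is_partition s t P" "u \<in> set P"
  shows "s \<le> u" "u \<le> t"
  using assms
proof (induction P arbitrary: s)
  case (Cons w P)
  {
    case 1
    then show ?case by (auto simp: is_partition_def)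
  next
    case 2
    show ?case
    proof (cases P)
      case Nil
      then show ?thesis using 2 by (auto simp: is_partition_def)
    next
      case (Cons v Q)
      then show ?thesis using Cons.IH(2)[of v] 2 is_partition_le[OF 2(1)]
        by (auto simp: is_partition_Cons_Cons)
    qed
  }
qed (simp_all add: is_partition_def)

lemma is_partition_sum_close:
  fixes y F :: "real \<Rightarrow> real"
  assumes "is_partition s t P"
    and "\<And>u v. (u, v) \<in> set (zip P (tl P)) \<Longrightarrow> s \<le> u \<Longrightarrow> u < v \<Longrightarrow> v \<le> t \<Longrightarrow>
      \<bar>(v - u) * F u - (y v - y u)\<bar> \<le> e * (v - u)"
  shows "\<bar>(\<Sum>(u, v) \<leftarrow> zip P (tl P). (v - u) * F u) - (y t - y s)\<bar> \<le> e * (t - s)"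
  using assms
proof (induction P arbitrary: s)
  case (Cons u P)
  show ?case
  proof (cases P)
    case Nil
    then show ?thesis using Cons.prems by (auto simp: is_partition_def)
  next
    case P: (Cons v Q)
    have u: "u = s" "u < v" and Q: "is_partition v t P"
      using Cons.prems(1) P by (simp_all add: is_partition_Cons_Cons)
    have vt: "v \<le> t" by (rule is_partition_le[OF Q])
    have 1: "\<bar>(\<Sum>(u, v) \<leftarrow> zip P (tl P). (v - u) * F u) - (y t - y v)\<bar> \<le> e * (t - v)"
      by (rule Cons.IH[OF Q]) (use Cons.prems(2) u in \<open>auto simp: P\<close>)
    have "\<bar>(v - u) * F u - (y v - y u)\<bar> \<le> e * (v - u)"
      using Cons.prems(2)[of u v] u vt by (simp add: P)
    moreover have "(\<Sum>(u, v) \<leftarrow> zip (u # P) (tl (u # P)). (v - u) * F u) =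
        (v - u) * F u + (\<Sum>(u, v) \<leftarrow> zip P (tl P). (v - u) * F u)"
      by (simp add: P)
    ultimately show ?thesis using 1 u by (simp add: algebra_simps)
  qed
qed (simp add: is_partition_def)

text \<open>
  On a fine partition each summand differs from the increment of \<open>y\<close> by at most \<open>e'\<close> times the length
  of its interval (mean value theorem and uniform continuity), and the increments telescope.
\<close>

lemma left_riemann_sums:
  fixes y F :: "real \<Rightarrow> real"
  assumes y: "\<And>r. s \<le> r \<Longrightarrow> r \<le> t \<Longrightarrow> (y has_real_derivative F r) (at r)"
    and F: "continuous_on {s..t} F" and e: "e > 0"
  shows "\<exists>d>0. \<forall>P. is_partition s t P \<and> (\<forall>(u, v) \<in> set (zip P (tl P)). v - u < d) \<longrightarrow>
    \<bar>(\<Sum>(u, v) \<leftarrow> zip P (tl P). (v - u) * F u) - (y t - y s)\<bar> < e"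
proof (cases "s \<le> t")
  case True
  \<comment> \<open>The \<open>+ 1\<close> keeps the quotient meaningful for \<open>s = t\<close>.\<close>
  define e' where "e' = e / (t - s + 1)"
  have e': "e' > 0" "e' * (t - s) < e"
    using e True by (simp_all add: e'_def field_simps)
  have "uniformly_continuous_on {s..t} F"
    by (rule compact_uniformly_continuous[OF F]) simp
  then obtain d where d: "d > 0"
    "\<And>u v. u \<in> {s..t} \<Longrightarrow> v \<in> {s..t} \<Longrightarrow> \<bar>v - u\<bar> < d \<Longrightarrow> \<bar>F v - F u\<bar> < e'"
    using e'(1) unfolding uniformly_continuous_on_def dist_real_def by metis
  have step: "\<bar>(v - u) * F u - (y v - y u)\<bar> \<le> e' * (v - u)"
    if uv: "s \<le> u" "u < v" "v \<le> t" "v - u < d" for u v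
  proof -
    obtain z where z: "u < z" "z < v" "y v - y u = (v - u) * F z"
      using MVT2[OF uv(2), of y F] y uv by auto
    have "\<bar>F z - F u\<bar> < e'" using z uv by (intro d) auto
    then have "(v - u) * \<bar>F u - F z\<bar> \<le> (v - u) * e'"
      using uv by (intro mult_left_mono) auto
    moreover have "(v - u) * F u - (y v - y u) = (v - u) * (F u - F z)"
      by (simp add: z(3) right_diff_distrib)
    ultimately show ?thesis using uv by (simp add: abs_mult mult.commute)
  qed
  have "\<bar>(\<Sum>(u, v) \<leftarrow> zip P (tl P). (v - u) * F u) - (y t - y s)\<bar> < e"
    if "is_partition s t P" "\<forall>(u, v) \<in> set (zip P (tl P)). v - u < d" for P
  proof -
    have "\<bar>(\<Sum>(u, v) \<leftarrow> zip P (tl P). (v - u) * F u) - (y t - y s)\<bar> \<le> e' * (t - s)"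
      by (rule is_partition_sum_close[OF that(1)]) (use that(2) step in auto)
    then show ?thesis using e' by simp
  qed
  then show ?thesis using d by blast
next
  case False
  then show ?thesis using is_partition_le zero_less_one by metis
qed

section \<open>The blow-up profile\<close>

text \<open>
  Both components \<open>y\<close> and \<open>y\<^sup>b\<close> of the solution are powers of \<open>1 - t/\<xi>\<close>.
\<close>

lemma powr_profile_derivative:
  fixes \<xi> p t :: real
  assumes "0 < \<xi>" "t < \<xi>"
  shows "((\<lambda>r. (1 - r / \<xi>) powr p) has_real_derivative - (p / \<xi>) * (1 - t / \<xi>) powr (p - 1)) (at t)"
proof -
  have "((\<lambda>r. 1 - r / \<xi>) has_real_derivative - (1 / \<xi>)) (at t)"
    using assms by (auto intro!: derivative_eq_intros)
  from DERIV_fun_powr[OF this, of p] show ?thesis using assms by simp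
qed

lemma continuous_on_powr_profile:
  fixes \<xi> p :: real
  assumes "0 < \<xi>" "b < \<xi>"
  shows "continuous_on {a..b} (\<lambda>r. (1 - r / \<xi>) powr p)"
  by (intro continuous_at_imp_continuous_on ballI DERIV_isCont[OF powr_profile_derivative]) (use assms in auto)

lemma powr_profile_at_top:
  fixes \<xi> p :: real
  assumes "0 < \<xi>" "p < 0"
  shows "filterlim (\<lambda>r. (1 - r / \<xi>) powr p) at_top (at_left \<xi>)"
proof -
  have "filterlim (\<lambda>r. 1 - r / \<xi>) (at_right 0) (at_left \<xi>)"
    unfolding filterlim_at
  proof
    show "\<forall>\<^sub>F r in at_left \<xi>. 1 - r / \<xi> \<in> {0<..} \<and> 1 - r / \<xi> \<noteq> 0"
      using assms by (auto simp: eventually_at_filter)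
    have "((\<lambda>r. 1 - r / \<xi>) \<longlongrightarrow> 1 - \<xi> / \<xi>) (at_left \<xi>)"
      using assms by (intro tendsto_intros) auto
    then show "((\<lambda>r. 1 - r / \<xi>) \<longlongrightarrow> 0) (at_left \<xi>)" using assms by simp
  qed
  moreover have "filterlim (\<lambda>x::real. - p * - ln x) at_top (at_right 0)"
    using assms ln_at_0
    by (intro filterlim_tendsto_pos_mult_at_top[OF tendsto_const]) (auto simp: filterlim_uminus_at_bot)
  then have "filterlim (\<lambda>x::real. exp (- p * - ln x)) at_top (at_right 0)"
    by (rule filterlim_compose[OF exp_at_top])
  then have "filterlim (\<lambda>x::real. x powr p) at_top (at_right 0)"
    by (rule filterlim_mono_eventually) (auto simp: eventually_at_filter powr_def)
  ultimately show ?thesis by (rule filterlim_compose[rotated])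
qed

section \<open>Explosion\<close>

theorem mainTheorem5:
  fixes N :: nat and \<gamma> \<epsilon> \<delta> :: real
    and fe :: "nat \<Rightarrow> real \<Rightarrow> real"
    and \<phi> :: "real ^ 2 \<Rightarrow> real ^ 2"
    and X :: "real \<Rightarrow> functional set"
  assumes "N \<ge> 2"
    and "1 / (real N + 1) < \<gamma>" and "\<gamma> \<le> 1 / real N"
    and "\<epsilon> > 0" and "\<delta> > 0" and "\<epsilon> > (real N - 1) * \<delta>"
    and "\<And>k. k \<in> {0, N - 1} \<Longrightarrow> fe k \<in> Cb (N - 1)"
    and "\<And>k. k \<in> {0, N - 1} \<Longrightarrow> (deriv ^^ k) (fe k) 0 = 1"
    and "\<And>k j. k \<in> {0, N - 1} \<Longrightarrow> j \<in> {0..N - 1} - {k} \<Longrightarrow> (deriv ^^ j) (fe k) 0 = 0"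
    and "\<And>x. x $ 1 > 0 \<Longrightarrow>
      \<phi> x = vector [(x $ 1) powr (1 / real N + \<epsilon>) * fe (N - 1) (x $ 2),
                    (x $ 1) powr (1 / real N - \<delta>) * fe 0 (x $ 2)]"
    and "\<And>t. t \<ge> 0 \<Longrightarrow> X t \<in> carrier (G N)"
    and "\<And>t. t \<ge> 0 \<Longrightarrow> pairing (X t) {#} = 1"
    and "\<And>t. t \<ge> 0 \<Longrightarrow> pairing (X t) (corolla (N - 1)) = t"
    and "\<And>t h. t \<ge> 0 \<Longrightarrow> h \<in> forests_upto N \<Longrightarrow> h \<noteq> {#} \<Longrightarrow> h \<noteq> corolla (N - 1) \<Longrightarrow>
      pairing (X t) h = 0"
  shows "(\<forall>T>0. branched_rough_path N \<gamma> T X) \<and>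
    explodes_in_finite_time N \<gamma> X {x. x $ 1 > 0} \<phi> (vector [1, 0])"
proof -
  note N = assms(1) and \<gamma> = assms(2,3) and \<phi> = assms(10)
  define n where "n = N - 1"
  have n: "n \<ge> 1" "N = Suc n" using N by (simp_all add: n_def)
  have \<gamma>0: "0 < \<gamma>" using \<gamma>(1) by (smt (verit) divide_pos_pos of_nat_0_le_iff)
  define T where "T = corolla n"
  have T: "vertices T = N" "N > 0" using n by (simp_all add: T_def vertices_corolla)
  have inc: "pairing (increment N X s t) f = (if f = {#} then 1 else if f = T then t - s else 0)"
    if "s \<ge> 0" "t \<ge> 0" "f \<in> forests_upto N" for s t f
    unfolding T_def n_def by (rule pairing_increment[OF N assms(11-14) that])

  define \<beta> where "\<beta> = \<epsilon> - real n * \<delta>"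
  have \<beta>: "\<beta> > 0" using assms(6) n by (simp add: \<beta>_def)
  \<comment> \<open>Blow-up time of \<open>y' = y\<^sup>1\<^sup>+\<^sup>\<beta> / n!\<close> started from \<open>1\<close>.\<close>
  define \<xi> where "\<xi> = fact n / \<beta>"
  have \<xi>: "\<xi> > 0" using \<beta> by (simp add: \<xi>_def)
  define a where "a = 1 / real N + \<epsilon>"
  define b where "b = 1 / real N - \<delta>"
  define y where "y = (\<lambda>t. (1 - t / \<xi>) powr (- (1 / \<beta>)))"
  define z where "z = (\<lambda>t. (1 - t / \<xi>) powr (- (b / \<beta>)))"
  have pos: "1 - t / \<xi> > 0" if "t < \<xi>" for t using that \<xi> by simp
  have y_pos: "y t > 0" if "t < \<xi>" for t unfolding y_def using pos[OF that] by (metis less_irrefl powr_gt_zero)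
  have y_powr: "y t powr b = z t" for t
    by (simp add: y_def z_def powr_powr)
  define F where "F = (\<lambda>t. y t powr a * z t ^ n / fact n)"
  \<comment> \<open>The exponents of the vector field add up to \<open>a + n b = 1 + \<beta>\<close>, so this is \<open>y\<^sup>1\<^sup>+\<^sup>\<beta> / n!\<close>.\<close>
  have F: "F t = (1 / fact n) * (1 - t / \<xi>) powr (- (1 / \<beta>) - 1)" if "t < \<xi>" for t
  proof -
    have "a + real n * b = 1 + \<beta>"
    proof -
      have "a + real n * b = (1 + real n) * (1 / real N) + \<epsilon> - real n * \<delta>"
        by (simp add: a_def b_def algebra_simps add_divide_distrib)
      then show ?thesis using n by (simp add: \<beta>_def)
    qed
    then have "- (a / \<beta>) + real n * - (b / \<beta>) = - (1 / \<beta>) - 1"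
      using \<beta> by (simp add: field_simps)
    moreover have "z t ^ n = (1 - t / \<xi>) powr (real n * - (b / \<beta>))"
      unfolding z_def by (rule powr_power) (use pos[OF that] in linarith)
    moreover have "y t powr a = (1 - t / \<xi>) powr (- (a / \<beta>))"
      by (simp add: y_def powr_powr)
    ultimately show ?thesis unfolding F_def by (simp flip: powr_add)
  qed
  have y': "(y has_real_derivative F t) (at t)" if "t < \<xi>" for t
  proof -
    have "- (- (1 / \<beta>) / \<xi>) = 1 / fact n" using \<beta> by (simp add: \<xi>_def)
    then show ?thesis
      using powr_profile_derivative[OF \<xi> that, of "- (1 / \<beta>)"] unfolding y_def F[OF that] by simp
  qed
  have F_cont: "continuous_on {s..t} F" if "t < \<xi>" for s t
  proof -
    have "continuous_on {s..t} (\<lambda>t. (1 / fact n) * (1 - t / \<xi>) powr (- (1 / \<beta>) - 1))"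
      by (intro continuous_on_mult_left continuous_on_powr_profile \<xi> that)
    then show ?thesis by (rule continuous_on_eq) (use F that in auto)
  qed

  define Y :: "forest \<Rightarrow> real \<Rightarrow> real ^ 2" where
    "Y = (\<lambda>f t. if f = {#} then vector [y t, 0] else if f = {#bullet#} then vector [0, z t] else 0)"
  have fe: "fe n \<in> Cb n" "fe 0 \<in> Cb n" using assms(7) by (simp_all add: n_def)
  have fe_n: "(deriv ^^ j) (fe n) 0 = (if j = n then 1 else 0)" if "j \<le> n" for j
    using assms(8)[of n] assms(9)[of n j] that by (auto simp: n_def)
  have fe_0: "(deriv ^^ j) (fe 0) 0 = (if j = 0 then 1 else 0)" if "j \<le> n" for j
    using assms(8)[of 0] assms(9)[of 0 j] that by (auto simp: n_def)
  have comp: "compose_controlled \<phi> Y f t =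
      (if f = {#} then vector [0, z t] else if f = replicate_mset n bullet then vector [F t, 0] else 0)"
    if "t < \<xi>" "f \<in> forests_upto n" for f t
    using compose_controlled_along_axis[OF n(1) _ fe fe_n fe_0 y_pos[OF that(1)], of \<phi> a b Y t "z t" f]
      \<phi> that(2)
    by (simp add: a_def b_def n_def Y_def F_def y_powr[unfolded b_def] vector_2_alt)

  have "controlled_rough_path N \<gamma> X {0..<\<xi>} Y"
  proof (rule controlled_rough_path_Lipschitz[OF \<gamma>0 \<gamma>(2) T(2)])
    show "remainder N X Y f s t = Y f t - Y f s"
      if "f \<in> forests_upto (N - 1)" "s \<in> {0..<\<xi>}" "t \<in> {0..<\<xi>}" for f s t
      using that inc by (intro remainder_eq_increment[OF T]) auto
    fix f and s t :: real assume st: "{s..t} \<subseteq> {0..<\<xi>}"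
    show "\<exists>L\<ge>0. \<forall>u v. s \<le> u \<and> u < v \<and> v \<le> t \<longrightarrow> norm (Y f v - Y f u) \<le> L * (v - u)"
    proof (cases "s \<le> t")
      case True
      then have t: "t < \<xi>" using st by auto
      consider "f = {#}" | "f = {#bullet#}" | "f \<noteq> {#}" "f \<noteq> {#bullet#}" by blast
      then show ?thesis
      proof cases
        case 1
        have "norm (Y f v - Y f u) = \<bar>y v - y u\<bar>" for u v
          using norm_vector_2_fst[of "y v - y u"] by (simp add: 1 Y_def vector_2_alt scaleR_diff_left)
        then show ?thesis using C1_imp_Lipschitz[of s t y F] y' F_cont t by simp
      next
        case 2
        have "norm (Y f v - Y f u) = \<bar>z v - z u\<bar>" for u v
          using norm_vector_2_snd[of "z v - z u"] by (simp add: 2 Y_def vector_2_alt scaleR_diff_left)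
        moreover have "\<exists>L\<ge>0. \<forall>u v. s \<le> u \<and> u < v \<and> v \<le> t \<longrightarrow> \<bar>z v - z u\<bar> \<le> L * (v - u)"
          unfolding z_def
        proof (rule C1_imp_Lipschitz)
          show "((\<lambda>r. (1 - r / \<xi>) powr (- (b / \<beta>))) has_real_derivative
              - (- (b / \<beta>) / \<xi>) * (1 - r / \<xi>) powr (- (b / \<beta>) - 1)) (at r)" if "r \<le> t" for r
            by (rule powr_profile_derivative) (use that t \<xi> in auto)
        qed (intro continuous_on_mult_left continuous_on_powr_profile \<xi> t)
        ultimately show ?thesis by simp
      qed (auto simp: Y_def intro!: exI[of _ 0])
    qed (auto intro!: exI[of _ 0])
  qed
  moreover have "Y {#} t \<in> {x. x $ 1 > 0}" if "t \<in> {0..<\<xi>}" for t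
    using y_pos that by (simp add: Y_def vector_2)
  moreover have "has_rough_integral N X \<phi> Y 0 t (Y {#} t - Y {#} 0)" if t: "t \<in> {0..<\<xi>}" for t
    unfolding has_rough_integral_def
  proof (intro allI impI)
    fix e :: real assume e: "e > 0"
    obtain d where d: "d > 0" "\<And>P. is_partition 0 t P \<and> (\<forall>(u, v) \<in> set (zip P (tl P)). v - u < d) \<Longrightarrow>
        \<bar>(\<Sum>(u, v) \<leftarrow> zip P (tl P). (v - u) * F u) - (y t - y 0)\<bar> < e"
      using left_riemann_sums[of 0 t y F e] y' F_cont t e by auto
    have "norm ((\<Sum>(u, v) \<leftarrow> zip P (tl P). \<Sum>f \<in> forests_upto (N - 1).
        pairing (increment N X u v) (graft f) *\<^sub>R compose_controlled \<phi> Y f u) - (Y {#} t - Y {#} 0)) < e"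
      if P: "is_partition 0 t P" "\<forall>(u, v) \<in> set (zip P (tl P)). v - u < d" for P
    proof -
      \<comment> \<open>The increment pairs with \<open>[f]\<close> to zero unless \<open>[f] = T\<close>; \<open>[f]\<close> is never the empty forest.\<close>
      have "(\<Sum>f \<in> forests_upto (N - 1).
          pairing (increment N X u v) (graft f) *\<^sub>R compose_controlled \<phi> Y f u) = vector [(v - u) * F u, 0]"
        if "0 \<le> u" "u \<le> t" "0 \<le> v" for u v
      proof -
        have "(\<Sum>f \<in> forests_upto (N - 1).
            pairing (increment N X u v) (graft f) *\<^sub>R compose_controlled \<phi> Y f u) =
            (\<Sum>f \<in> forests_upto n. if f = replicate_mset n bullet then vector [(v - u) * F u, 0] else 0)"
        proof (rule sum.cong)
          fix f assume f: "f \<in> forests_upto n"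
          then have "pairing (increment N X u v) (graft f) = (if f = replicate_mset n bullet then v - u else 0)"
            using inc[of u v "graft f"] that n
            by (simp add: forests_upto_def vertices_graft T_def corolla_def graft_eq_iff) (simp add: graft_def)
          then show "pairing (increment N X u v) (graft f) *\<^sub>R compose_controlled \<phi> Y f u =
              (if f = replicate_mset n bullet then vector [(v - u) * F u, 0] else 0)"
            using comp[of u f] f t that n by (auto simp: vector_2_alt)
        qed (simp add: n_def)
        moreover have "replicate_mset n bullet \<in> forests_upto n"
          using vertices_corolla[of n] by (simp add: corolla_def vertices_graft forests_upto_def)
        ultimately show ?thesis using finite_forests_upto by simp
      qed
      moreover have "0 \<le> u \<and> u \<le> t \<and> 0 \<le> v" if "(u, v) \<in> set (zip P (tl P))" for u v
        using is_partition_bounds[OF P(1)] that set_zip_leftD[OF that] set_zip_rightD[OF that]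
        by (cases P) auto
      ultimately have "(\<Sum>(u, v) \<leftarrow> zip P (tl P). \<Sum>f \<in> forests_upto (N - 1).
          pairing (increment N X u v) (graft f) *\<^sub>R compose_controlled \<phi> Y f u) =
          (\<Sum>(u, v) \<leftarrow> zip P (tl P). vector [(v - u) * F u, 0])"
        by (intro arg_cong[of _ _ sum_list] map_cong refl) auto
      also have "\<dots> = vector [\<Sum>(u, v) \<leftarrow> zip P (tl P). (v - u) * F u, 0]"
        by (rule sum_list_vector_2)
      finally have "norm ((\<Sum>(u, v) \<leftarrow> zip P (tl P). \<Sum>f \<in> forests_upto (N - 1).
          pairing (increment N X u v) (graft f) *\<^sub>R compose_controlled \<phi> Y f u) - (Y {#} t - Y {#} 0)) =
          \<bar>(\<Sum>(u, v) \<leftarrow> zip P (tl P). (v - u) * F u) - (y t - y 0)\<bar>"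
        by (simp add: Y_def vector_2_alt flip: scaleR_diff_left)
      then show ?thesis using d(2)[of P] P by simp
    qed
    then show "\<exists>d>0. \<forall>P. is_partition 0 t P \<and> (\<forall>(u, v) \<in> set (zip P (tl P)). v - u < d) \<longrightarrow>
        norm ((\<Sum>(u, v) \<leftarrow> zip P (tl P). \<Sum>f \<in> forests_upto (N - 1).
          pairing (increment N X u v) (graft f) *\<^sub>R compose_controlled \<phi> Y f u) - (Y {#} t - Y {#} 0)) < e"
      using d(1) by blast
  qed
  moreover have "Y (graft f) t = compose_controlled \<phi> Y f t"
    if "f \<in> forests_upto (N - 2)" "t \<in> {0..<\<xi>}" for f t
  proof -
    \<comment> \<open>With at most \<open>N - 2\<close> vertices, \<open>f\<close> is too small to be \<open>\<bullet>\<^sup>n\<close>, so only \<open>f = 1\<close> contributes.\<close>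
    have "f \<in> forests_upto n" "size f < n"
      using that(1) n size_le_vertices[of f] by (auto simp: forests_upto_def)
    then show ?thesis
      using comp[of t f] that(2) graft_eq_iff[of f "{#}"]
      by (auto simp: Y_def graft_empty) (auto simp: graft_def)
  qed
  moreover have "Y f t = 0" if "size f \<ge> 2" for f t
    using that by (auto simp: Y_def)
  ultimately have sol: "rde_solution N \<gamma> X {x. x $ 1 > 0} \<phi> {0..<\<xi>} Y"
    unfolding rde_solution_def by blast
  have "Y {#} 0 = vector [1, 0]" by (simp add: Y_def y_def)
  moreover have "filterlim (\<lambda>t. norm (Y {#} t)) at_top (at_left \<xi>)"
    using powr_profile_at_top[OF \<xi>, of "- (1 / \<beta>)"] \<beta>
    by (simp add: Y_def norm_vector_2_fst y_def)
  ultimately have "explodes_in_finite_time N \<gamma> X {x. x $ 1 > 0} \<phi> (vector [1, 0])"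
    unfolding explodes_in_finite_time_def using sol \<xi> by blast
  moreover have "branched_rough_path N \<gamma> S X" for S
    by (rule branched_rough_path_one_plus[OF assms(11) T \<gamma>(2) inc])
  ultimately show ?thesis by blast
qed

end
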